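(* For any integer $n\geq 0$, there exists a (weight-preserving) bijection between $\mathbf{h}_a\mathcal{G}_n^{\mathbf{uvu,uu}}(a,b,b^2)$ and $\mathcal{C}_{n+1}(a,b)$.
   Context: A G-Motzkin path of length $n$ is a lattice path from $(0,0)$ to $(n,0)$ in the first quadrant (never going below the $x$-axis) consisting of up steps $\mathbf{u}=(1,1)$, down steps $\mathbf{d}=(1,-1)$, horizontal steps $\mathbf{h}=(1,0)$ and vertical steps $\mathbf{v}=(0,-1)$. Here $a,b$ are commuting indeterminates. An $(a,b,c)$-G-Motzkin path is a G-Motzkin path in which each $\mathbf{u}$-, $\mathbf{h}$-, $\mathbf{v}$-, $\mathbf{d}$-step has weight $1,a,b,c$ respectively. $\mathcal{G}_n^{\mathbf{uvu,uu}}(a,b,b^2)$ is the set of all $(a,b,b^2)$-G-Motzkin paths of length $n$ that contain neither three consecutive steps $\mathbf{u},\mathbf{v},\mathbf{u}$ nor two consecutive steps $\mathbf{u},\mathbf{u}$. $\mathbf{h}_a\mathcal{G}_n^{\mathbf{uvu,uu}}(a,b,b^2)$ is the subset of paths in $\mathcal{G}_{n+1}^{\mathbf{uvu,uu}}(a,b,b^2)$ that start with an $\mathbf{h}$-step (of weight $a$). A Dyck path of length $2n$ is a G-Motzkin path of length $2n$ with no $\mathbf{h}$-steps and no $\mathbf{v}$-steps. A $\mathbf{ud}$-peak is an occurrence of consecutive steps $\mathbf{u}\mathbf{d}$. An $(a,b)$-Dyck path is a Dyck path in which $\mathbf{u}$-steps have weight $1$, the $\mathbf{d}$-steps in $\mathbf{ud}$-peaks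 have weight $a$, and all other $\mathbf{d}$-steps have weight $b$; $\mathcal{C}_n(a,b)$ is the set of $(a,b)$-Dyck paths of length $2n$. The weight of a path is the product of the weights of its steps; a bijection is weight-preserving if every path and its image have the same weight. *)

theory Defs
  imports Main "HOL-Library.Sublist" "HOL-Computational_Algebra.Polynomial"
begin

datatype step = U | H | V | D

fun step_vec :: "step \<Rightarrow> int \<times> int" where
  "step_vec U = (1, 1)"
| "step_vec H = (1, 0)"
| "step_vec V = (0, -1)"
| "step_vec D = (1, -1)"

definition xpos :: "step list \<Rightarrow> int" where
  "xpos w = (\<Sum>s\<leftarrow>w. fst (step_vec s))"

definition ypos :: "step list \<Rightarrow> int" where
  "ypos w = (\<Sum>s\<leftarrow>w. snd (step_vec s))"

text \<open>
  A lattice path from the origin is the list of its steps; the lattice points it visits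
  are the end points of its prefixes. Its length is the abscissa of its end point, which
  is not the length of the list, because vertical steps do not advance the abscissa.
\<close>

definition gmotzkin :: "nat \<Rightarrow> step list set" where
  "gmotzkin n = {w. (\<forall>k\<le>length w. 0 \<le> xpos (take k w) \<and> 0 \<le> ypos (take k w)) \<and>
                    xpos w = int n \<and> ypos w = 0}"

fun step_weight :: "'a \<Rightarrow> 'a \<Rightarrow> 'a \<Rightarrow> step \<Rightarrow> 'a::comm_semiring_1" where
  "step_weight a b c U = 1"
| "step_weight a b c H = a"
| "step_weight a b c V = b"
| "step_weight a b c D = c"

definition gmotzkin_weight :: "'a \<Rightarrow> 'a \<Rightarrow> 'a \<Rightarrow> step list \<Rightarrow> 'a::comm_semiring_1" where
  "gmotzkin_weight a b c w = (\<Prod>s\<leftarrow>w. step_weight a b c s)"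

text \<open>The relation \<^const>\<open>sublist\<close> is that of contiguous sublists.\<close>

definition gmotzkin_uvu_uu :: "nat \<Rightarrow> step list set" where
  "gmotzkin_uvu_uu n = {w \<in> gmotzkin n. \<not> sublist [U, V, U] w \<and> \<not> sublist [U, U] w}"

definition h_gmotzkin_uvu_uu :: "nat \<Rightarrow> step list set" where
  "h_gmotzkin_uvu_uu n = {w \<in> gmotzkin_uvu_uu (n + 1). \<exists>w'. w = H # w'}"

definition dyck :: "nat \<Rightarrow> step list set" where
  "dyck n = {w \<in> gmotzkin (2 * n). H \<notin> set w \<and> V \<notin> set w}"

text \<open>Only meant for words in \<^const>\<open>U\<close> and \<^const>\<open>D\<close>: all other steps get weight 1.\<close>

definition dyck_weight :: "'a \<Rightarrow> 'a \<Rightarrow> step list \<Rightarrow> 'a::comm_semiring_1" where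
  "dyck_weight a b w =
     (\<Prod>i<length w. if w ! i = D then (if i > 0 \<and> w ! (i - 1) = U then a else b) else 1)"

text \<open>
  The commuting indeterminates \<open>a\<close> and \<open>b\<close>, as elements of the polynomial ring
  \<open>\<int>[a][b]\<close>.
\<close>

definition indet_a :: "int poly poly" where
  "indet_a = [:[:0, 1:]:]"

definition indet_b :: "int poly poly" where
  "indet_b = [:0, 1:]"

end

theory Submission
  imports Defs
begin

text \<open>
  Cutting at the first return to the axis identifies Dyck paths with binary trees, the tree
  \<open>N l r\<close> standing for \<open>U l D r\<close>. If \<open>T\<close> is the weighted generating function of the nonempty
  Dyck paths, this says \<open>T = x (a + b T) (1 + T)\<close>, because the closing \<open>D\<close> belongs to a peak
  iff \<open>l\<close> is empty.

  On the other side let \<open>G\<close> count the G-Motzkin paths without \<open>uu\<close> and \<open>uvu\<close>, and \<open>S = a x G\<close>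
  those that start with \<open>H\<close>. Cut such a path after its first \<open>H\<close>, and cut what follows at its
  first return. Below an initial \<open>U\<close> there is a path that does not start with \<open>U\<close>, so it is
  counted by \<open>1 + S\<close>; and if a \<open>V\<close> follows that \<open>U\<close> immediately, what remains does not start with
  \<open>U\<close> either. Hence
  \<open>S = a x (1 + S) + a b x^2 (1 + S) + b x S S + b^2 x^2 (1 + S) S\<close>,
  where \<open>a x\<close> has been absorbed into each factor \<open>G\<close>. The first term and the third match the
  Dyck paths \<open>U D r\<close> and \<open>U l D r\<close> with \<open>l\<close> and \<open>r\<close> nonempty. The remaining Dyck paths are
  \<open>U l D\<close> with \<open>l = U t D c\<close> nonempty; the second term matches those with \<open>t\<close> empty and the fourth
  those with \<open>t\<close> nonempty. Reading these matches recursively gives a map from binary trees to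
  G-Motzkin paths (\<open>motzkin_of\<close>) beside the one to Dyck paths (\<open>dyck_of\<close>). Both are bijections
  onto the respective families, by uniqueness (\<open>first_return_unique\<close>) and existence
  (\<open>first_return_exists\<close>) of the first return, and they give the same weight to a tree.
\<close>

section \<open>Excursions and their first return\<close>

fun excursion :: "nat \<Rightarrow> step list \<Rightarrow> bool" where
  "excursion h [] \<longleftrightarrow> h = 0"
| "excursion h (U # w) \<longleftrightarrow> excursion (Suc h) w"
| "excursion h (H # w) \<longleftrightarrow> excursion h w"
| "excursion h (V # w) \<longleftrightarrow> h > 0 \<and> excursion (h - 1) w"
| "excursion h (D # w) \<longleftrightarrow> h > 0 \<and> excursion (h - 1) w"

lemma xpos_simps [simp]:
  "xpos [] = 0" "xpos (s # w) = fst (step_vec s) + xpos w" "xpos (v @ w) = xpos v + xpos w"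
  by (simp_all add: xpos_def)

lemma ypos_simps [simp]:
  "ypos [] = 0" "ypos (s # w) = snd (step_vec s) + ypos w"
  by (simp_all add: ypos_def)

lemma xpos_nonneg: "0 \<le> xpos w"
proof (induction w)
  case (Cons s w)
  then show ?case by (cases s) auto
qed simp

lemma all_le_Suc_shift: "(\<forall>k\<le>Suc n. P k) \<longleftrightarrow> P 0 \<and> (\<forall>k\<le>n. P (Suc k))"
  by (metis Suc_le_mono le0 not0_implies_Suc)

lemma excursion_iff_ypos:
  "excursion h w \<longleftrightarrow> (\<forall>k\<le>length w. 0 \<le> int h + ypos (take k w)) \<and> int h + ypos w = 0"
proof (induction w arbitrary: h)
  case (Cons s w)
  have "?case" if "s = V \<or> s = D"
  proof (cases h)
    case 0
    then have "\<not> (\<forall>k\<le>length (s # w). 0 \<le> int h + ypos (take k (s # w)))"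
      using that by (auto intro!: exI[of _ 1])
    with 0 that show ?thesis by auto
  next
    case (Suc m)
    with that Cons.IH[of m] show ?thesis
      by (auto simp: all_le_Suc_shift algebra_simps)
  qed
  moreover have "?case" if "s = U \<or> s = H"
    using that Cons.IH[of h] Cons.IH[of "Suc h"] by (auto simp: all_le_Suc_shift algebra_simps)
  ultimately show ?case by (cases s) blast+
qed simp

lemma gmotzkin_iff_excursion: "w \<in> gmotzkin n \<longleftrightarrow> excursion 0 w \<and> xpos w = int n"
  by (auto simp: gmotzkin_def excursion_iff_ypos xpos_nonneg)

lemma excursion_append: "excursion h v \<Longrightarrow> excursion (h + k) (v @ w) \<longleftrightarrow> excursion k w"
proof (induction v arbitrary: h)
  case (Cons s v)
  from Cons.IH[of h] Cons.IH[of "Suc h"] Cons.IH[of "h - 1"] Cons.prems show ?case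
    by (cases s; cases h) auto
qed simp

lemma excursion_append0 [simp]: "excursion 0 v \<Longrightarrow> excursion k (v @ w) \<longleftrightarrow> excursion k w"
  using excursion_append[of 0] by simp

lemma first_return_exists:
  assumes "excursion (Suc h) w"
  shows "\<exists>v s u. w = v @ s # u \<and> excursion 0 v \<and> (s = V \<or> s = D) \<and> excursion h u"
  using assms
proof (induction w arbitrary: h rule: length_induct)
  case (1 w)
  show ?case
  proof (cases w)
    case (Cons x w')
    show ?thesis
    proof (cases x)
      case U
      \<comment> \<open>From height \<open>h + 2\<close> the path returns first to \<open>h + 1\<close> and only then to \<open>h\<close>.\<close>
      with 1 Cons obtain v s u where
        v: "w' = v @ s # u" "excursion 0 v" "s = V \<or> s = D" "excursion (Suc h) u"
        by (metis excursion.simps(2) length_Cons lessI)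
      have "length u < length w" using Cons v(1) by simp
      with 1(1) v(4) obtain v' s' u' where
        v': "u = v' @ s' # u'" "excursion 0 v'" "s' = V \<or> s' = D" "excursion h u'"
        by blast
      have "w = (U # v @ s # v') @ s' # u'" using Cons U v v' by simp
      moreover have "excursion 0 (U # v @ s # v')" using v v' by auto
      ultimately show ?thesis using v' by blast
    next
      case H
      with 1 Cons obtain v s u where
        "w' = v @ s # u" "excursion 0 v" "s = V \<or> s = D" "excursion h u"
        by (metis excursion.simps(3) length_Cons lessI)
      with Cons H show ?thesis by (intro exI[of _ "H # v"]) auto
    next
      case V
      with 1 Cons show ?thesis by (intro exI[of _ "[]"]) auto
    next
      case D
      with 1 Cons show ?thesis by (intro exI[of _ "[]"]) auto
    qed
  qed (use 1 in simp)
qed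

text \<open>
  If one prefix were shorter, the other would contain the descent below the axis that follows it.
\<close>

lemma first_return_unique:
  assumes "excursion 0 v" "excursion 0 v'" "s = V \<or> s = D" "s' = V \<or> s' = D"
  shows "v @ s # u = v' @ s' # u' \<longleftrightarrow> v = v' \<and> s = s' \<and> u = u'"
proof
  assume eq: "v @ s # u = v' @ s' # u'"
  have *: "\<not> excursion 0 (x @ r # y)" if "excursion 0 x" "r = V \<or> r = D" for x r y
    using that by auto
  from eq obtain z where "v = v' @ z \<and> z @ s # u = s' # u' \<or> v @ z = v' \<and> s # u = z @ s' # u'"
    by (auto simp: append_eq_append_conv2)
  then show "v = v' \<and> s = s' \<and> u = u'"
    using assms *[of v s] *[of v' s'] by (cases z) auto
qed simp

lemma excursion_not_ends_up: "excursion h w \<Longrightarrow> w \<noteq> [] \<Longrightarrow> last w \<noteq> U"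
proof (induction w arbitrary: h)
  case (Cons s w)
  then show ?case by (cases s; cases w) auto
qed simp

section \<open>Avoiding uvu and uu\<close>

definition avoiding :: "step list \<Rightarrow> bool" where
  "avoiding w \<longleftrightarrow> \<not> sublist [U, V, U] w \<and> \<not> sublist [U, U] w"

lemma avoiding_simps [simp]:
  "avoiding []"
  "avoiding (H # w) \<longleftrightarrow> avoiding w"
  "avoiding (V # w) \<longleftrightarrow> avoiding w"
  "avoiding (D # w) \<longleftrightarrow> avoiding w"
  "avoiding (U # w) \<longleftrightarrow> avoiding w \<and> \<not> prefix [V, U] w \<and> \<not> prefix [U] w"
  by (auto simp: avoiding_def sublist_Cons_right)

text \<open>
  A forbidden pattern across the cut would be \<open>uvu\<close> with \<open>s\<close> as its \<open>V\<close>, but no \<open>U\<close> precedes \<open>s\<close>.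
\<close>

lemma avoiding_append:
  assumes "v = [] \<or> last v \<noteq> U" "s = V \<or> s = D"
  shows "avoiding (v @ s # u) \<longleftrightarrow> avoiding v \<and> avoiding u"
  using assms(1)
proof (induction v)
  case Nil
  then show ?case using assms(2) by auto
next
  case (Cons x v)
  then have IH: "avoiding (v @ s # u) \<longleftrightarrow> avoiding v \<and> avoiding u" by (cases v) auto
  show ?case
  proof (cases x)
    case U
    with Cons.prems obtain y v' where "v = y # v'" by (cases v) auto
    with U IH assms(2) show ?thesis by (cases v') auto
  qed (use IH in auto)
qed

lemma avoiding_first_return [simp]:
  "excursion 0 v \<Longrightarrow> avoiding (v @ V # u) \<longleftrightarrow> avoiding v \<and> avoiding u"
  "excursion 0 v \<Longrightarrow> avoiding (v @ D # u) \<longleftrightarrow> avoiding v \<and> avoiding u"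
  by (metis avoiding_append excursion_not_ends_up)+

lemma h_gmotzkin_uvu_uu_iff:
  "w \<in> h_gmotzkin_uvu_uu n \<longleftrightarrow>
     excursion 0 w \<and> avoiding w \<and> xpos w = int (n + 1) \<and> (\<exists>w'. w = H # w')"
  by (auto simp: h_gmotzkin_uvu_uu_def gmotzkin_uvu_uu_def gmotzkin_iff_excursion avoiding_def)

section \<open>Binary trees as Dyck paths\<close>

datatype tree = L | N tree tree

fun nodes :: "tree \<Rightarrow> nat" where
  "nodes L = 0"
| "nodes (N l r) = Suc (nodes l + nodes r)"

fun dyck_of :: "tree \<Rightarrow> step list" where
  "dyck_of L = []"
| "dyck_of (N l r) = U # dyck_of l @ D # dyck_of r"

lemma excursion_dyck_of [simp]: "excursion 0 (dyck_of t)"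
  by (induction t) auto

lemma xpos_dyck_of: "xpos (dyck_of t) = 2 * int (nodes t)"
  by (induction t) auto

lemma set_dyck_of: "set (dyck_of t) \<subseteq> {U, D}"
  by (induction t) auto

lemma inj_dyck_of: "inj dyck_of"
proof (rule injI)
  show "dyck_of s = dyck_of t \<Longrightarrow> s = t" for s t
  proof (induction s arbitrary: t)
    case L
    then show ?case by (cases t) auto
  next
    case (N l r)
    then show ?case by (cases t) (auto simp: first_return_unique)
  qed
qed

lemma dyck_of_surj:
  assumes "excursion 0 w" "set w \<subseteq> {U, D}"
  shows "w \<in> range dyck_of"
  using assms
proof (induction w rule: length_induct)
  case (1 w)
  show ?case
  proof (cases w)
    case Nil
    then show ?thesis by (metis dyck_of.simps(1) rangeI)
  next
    case (Cons x w')
    with 1 have "x = U" "excursion (Suc 0) w'" by (cases x; auto)+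
    with first_return_exists obtain v s u where
      w: "w' = v @ s # u" "excursion 0 v" "s = V \<or> s = D" "excursion 0 u"
      by blast
    with 1 Cons have "v \<in> range dyck_of" "u \<in> range dyck_of" by auto
    then obtain l r where "v = dyck_of l" "u = dyck_of r" by blast
    then have "w = dyck_of (N l r)" using w Cons \<open>x = U\<close> 1 by auto
    then show ?thesis by blast
  qed
qed

lemma bij_betw_dyck_of: "bij_betw dyck_of {t. nodes t = n} (dyck n)"
proof (rule bij_betw_imageI)
  show "inj_on dyck_of {t. nodes t = n}"
    using inj_dyck_of by (auto intro: inj_on_subset)
  have "w \<in> dyck_of ` {t. nodes t = n}" if "w \<in> dyck n" for w
  proof -
    have *: "set w \<subseteq> {U, D}"
    proof
      show "s \<in> {U, D}" if "s \<in> set w" for s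
        using that \<open>w \<in> dyck n\<close> step.exhaust[of s] by (auto simp: dyck_def)
    qed
    from that have "excursion 0 w" and x: "xpos w = 2 * int n"
      by (auto simp: dyck_def gmotzkin_iff_excursion)
    with * obtain t where "w = dyck_of t" using dyck_of_surj by blast
    with x show ?thesis by (auto simp: xpos_dyck_of)
  qed
  moreover have "dyck_of t \<in> dyck (nodes t)" for t
    using set_dyck_of[of t] by (auto simp: dyck_def gmotzkin_iff_excursion xpos_dyck_of)
  ultimately show "dyck_of ` {t. nodes t = n} = dyck n" by auto
qed

section \<open>Binary trees as G-Motzkin paths\<close>

text \<open>
  The image of a nonempty tree starts with \<open>H\<close>; its tail ranges over all avoiding paths, which is
  what may stand after the first return.
\<close>

fun motzkin_of :: "tree \<Rightarrow> step list" where
  "motzkin_of L = []"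
| "motzkin_of (N L r) = H # motzkin_of r"
| "motzkin_of (N (N L c) L) = H # U # V # motzkin_of c"
| "motzkin_of (N (N (N t1 t2) c) L) = H # U # motzkin_of c @ D # tl (motzkin_of (N t1 t2))"
| "motzkin_of (N (N l1 l2) (N r1 r2)) =
     H # U # motzkin_of (N l1 l2) @ V # tl (motzkin_of (N r1 r2))"

lemma motzkin_of_N: "motzkin_of (N l r) = H # tl (motzkin_of (N l r))"
  by (cases "N l r" rule: motzkin_of.cases) auto

lemma motzkin_of_starts [simp]:
  "\<not> prefix (U # v) (motzkin_of t)" "\<not> prefix (V # v) (motzkin_of t)"
  by (cases t, simp, metis motzkin_of_N prefix_Cons list.inject list.distinct(1) step.distinct)+

lemma motzkin_of_tl:
  "excursion 0 (tl (motzkin_of (N l r))) \<longleftrightarrow> excursion 0 (motzkin_of (N l r))"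
  "avoiding (tl (motzkin_of (N l r))) \<longleftrightarrow> avoiding (motzkin_of (N l r))"
  "xpos (tl (motzkin_of (N l r))) = xpos (motzkin_of (N l r)) - 1"
  by (subst (2) motzkin_of_N, simp)+

lemma excursion_motzkin_of [simp]: "excursion 0 (motzkin_of t)"
  by (induction t rule: motzkin_of.induct) (auto simp: motzkin_of_tl)

lemma xpos_motzkin_of: "xpos (motzkin_of t) = int (nodes t)"
  by (induction t rule: motzkin_of.induct) (auto simp: motzkin_of_tl)

lemma not_prefix_append_down:
  assumes "\<not> prefix [U] v" "\<not> prefix [V, U] v" "s = V \<or> s = D" "v \<noteq> [] \<or> s = D"
  shows "\<not> prefix [U] (v @ s # u)" "\<not> prefix [V, U] (v @ s # u)"
  using assms by (auto simp: prefix_def Cons_eq_append_conv append_eq_Cons_conv)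

lemma avoiding_motzkin_of: "avoiding (motzkin_of t)"
proof (induction t rule: motzkin_of.induct)
  case (5 l1 l2 r1 r2)
  moreover have "motzkin_of (N l1 l2) \<noteq> []" using motzkin_of_N by (metis list.distinct(1))
  ultimately show ?case
    by (simp add: motzkin_of_tl not_prefix_append_down del: motzkin_of.simps(2-4))
qed (simp_all add: motzkin_of_tl not_prefix_append_down)

text \<open>
  The case of the definition can be read off the path: either no \<open>U\<close> follows the first \<open>H\<close>, or
  the return from that \<open>U\<close> is a \<open>V\<close> that comes at once, a later \<open>V\<close>, or a \<open>D\<close>.
\<close>

lemma inj_motzkin_of: "inj motzkin_of"
proof (rule injI)
  have tl: "s1 = t1 \<and> s2 = t2"
    if "tl (motzkin_of (N s1 s2)) = tl (motzkin_of (N t1 t2))"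
       "\<And>t. motzkin_of (N s1 s2) = motzkin_of t \<Longrightarrow> N s1 s2 = t" for s1 s2 t1 t2
    using that by (metis motzkin_of_N tree.inject)
  have no_UV: "motzkin_of t \<noteq> U # w" "motzkin_of t \<noteq> V # w" for t w
    by (metis motzkin_of_starts append_Nil2 prefixI)+
  have no_V: "motzkin_of t @ D # u \<noteq> V # w" "motzkin_of (N l r) @ V # u \<noteq> V # w" for t l r u w
    using no_UV(2) motzkin_of_N[of l r] by (auto simp: append_eq_Cons_conv)
  note no = no_UV no_V no_UV[symmetric] no_V[symmetric]
  show "motzkin_of s = motzkin_of t \<Longrightarrow> s = t" for s t
  proof (induction s arbitrary: t rule: motzkin_of.induct)
    case 1
    then show ?case by (cases t rule: motzkin_of.cases) simp_all
  next
    case (2 r)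
    then show ?case by (cases t rule: motzkin_of.cases) (simp_all add: no)
  next
    case (3 c)
    then show ?case
      by (cases t rule: motzkin_of.cases)
        (simp_all add: no)
  next
    case (4 t1 t2 c)
    then show ?case
      by (cases t rule: motzkin_of.cases)
        (auto simp: no first_return_unique dest: tl)
  next
    case (5 l1 l2 r1 r2)
    then show ?case
      by (cases t rule: motzkin_of.cases)
        (auto simp: no first_return_unique dest: tl)
  qed
qed

lemma motzkin_of_surj:
  assumes "excursion 0 w" "avoiding w" "\<not> prefix [U] w"
  shows "w \<in> range motzkin_of"
  using assms
proof (induction w rule: length_induct)
  case (1 w)
  have IH: "v \<in> range motzkin_of"
    if "length v < length w" "excursion 0 v" "avoiding v" "\<not> prefix [U] v" for v
    using 1 that by blast
  show ?case
  proof (cases w)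
    case Nil
    then show ?thesis by (metis motzkin_of.simps(1) rangeI)
  next
    case (Cons x w1)
    with 1(2,4) have w: "w = H # w1" by (cases x) auto
    with 1 have w1: "excursion 0 w1" "avoiding w1" by auto
    show ?thesis
    proof (cases "prefix [U] w1")
      case False
      with IH[of w1] w w1 obtain r where "w1 = motzkin_of r" by auto
      then have "w = motzkin_of (N L r)" using w by simp
      then show ?thesis by blast
    next
      case True
      then obtain w2 where w2: "w1 = U # w2" by (auto simp: prefix_def)
      with w1 first_return_exists[of 0 w2] obtain v s u where
        w2': "w2 = v @ s # u" and exc: "excursion 0 v" "excursion 0 u" and s: "s = V \<or> s = D"
        by auto
      with w1 w2 have av: "avoiding v" "avoiding u" and pre: "\<not> prefix [U] w2" "\<not> prefix [V, U] w2"
        by (auto simp: avoiding_append)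
      from pre(1) w2' have "\<not> prefix [U] v" by (cases v) auto
      with IH[of v] exc av w w2 w2' obtain c where c: "v = motzkin_of c" by auto
      \<comment> \<open>Lending an initial \<open>H\<close> to \<open>u\<close>, which may start with \<open>U\<close>, still leaves a shorter path.\<close>
      from IH[of "H # u"] exc av w w2 w2' obtain r where "H # u = motzkin_of r" by auto
      then obtain r1 r2 where r: "H # u = motzkin_of (N r1 r2)"
        by (cases r) auto
      then have u: "u = tl (motzkin_of (N r1 r2))" by (metis list.sel(3))
      consider "s = D" | "s = V" "c = L" | l1 l2 where "s = V" "c = N l1 l2"
        using s by (cases c) auto
      then show ?thesis
      proof cases
        case 1
        then have "w = motzkin_of (N (N (N r1 r2) c) L)" using w w2 w2' c u by simp
        then show ?thesis by blast
      next
        case 2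
        with pre(2) w2' c have "\<not> prefix [U] u" by simp
        with IH[of u] exc av w w2 w2' obtain c' where "u = motzkin_of c'" by auto
        then have "w = motzkin_of (N (N L c') L)" using w w2 w2' c 2 by simp
        then show ?thesis by blast
      next
        case 3
        then have "w = motzkin_of (N c (N r1 r2))" using w w2 w2' c u by simp
        then show ?thesis by blast
      qed
    qed
  qed
qed

lemma bij_betw_motzkin_of:
  "bij_betw motzkin_of {t. nodes t = n + 1} (h_gmotzkin_uvu_uu n)"
proof (rule bij_betw_imageI)
  show "inj_on motzkin_of {t. nodes t = n + 1}"
    using inj_motzkin_of by (auto intro: inj_on_subset)
  have "w \<in> motzkin_of ` {t. nodes t = n + 1}" if "w \<in> h_gmotzkin_uvu_uu n" for w
  proof -
    from that have "w \<in> range motzkin_of"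
      by (intro motzkin_of_surj) (auto simp: h_gmotzkin_uvu_uu_iff)
    then obtain t where "w = motzkin_of t" by blast
    with that show ?thesis by (auto simp: h_gmotzkin_uvu_uu_iff xpos_motzkin_of)
  qed
  moreover have "motzkin_of t \<in> h_gmotzkin_uvu_uu n" if "nodes t = n + 1" for t
    using that motzkin_of_N
    by (cases t) (auto simp: h_gmotzkin_uvu_uu_iff avoiding_motzkin_of xpos_motzkin_of
        simp del: motzkin_of.simps)
  ultimately show "motzkin_of ` {t. nodes t = n + 1} = h_gmotzkin_uvu_uu n" by blast
qed

section \<open>Weights\<close>

lemma gmotzkin_weight_simps [simp]:
  "gmotzkin_weight a b c [] = 1"
  "gmotzkin_weight a b c (s # w) = step_weight a b c s * gmotzkin_weight a b c w"
  "gmotzkin_weight a b c (v @ w) = gmotzkin_weight a b c v * gmotzkin_weight a b c w"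
  by (simp_all add: gmotzkin_weight_def)

text \<open>
  To split the weight of a Dyck path at a step, one must know the preceding step; \<open>p\<close> is the step
  before the word. At the start of a path any \<open>p\<close> other than \<open>U\<close> will do.
\<close>

fun dyck_weight_after :: "'a \<Rightarrow> 'a \<Rightarrow> step \<Rightarrow> step list \<Rightarrow> 'a::comm_semiring_1" where
  "dyck_weight_after a b p [] = 1"
| "dyck_weight_after a b p (s # w) =
     (if s = D then (if p = U then a else b) else 1) * dyck_weight_after a b s w"

lemma dyck_weight_after_eq_prod:
  "dyck_weight_after a b p w =
     (\<Prod>i<length w. if w ! i = D then (if (p # w) ! i = U then a else b) else 1)"
  by (induction w arbitrary: p) (simp_all add: prod.lessThan_Suc_shift del: prod.lessThan_Suc cong: if_cong)

lemma dyck_weight_eq_after: "dyck_weight a b w = dyck_weight_after a b D w"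
  unfolding dyck_weight_def dyck_weight_after_eq_prod
  by (intro prod.cong) (auto simp: nth_Cons')

lemma dyck_weight_after_append:
  "dyck_weight_after a b p (v @ w) =
     dyck_weight_after a b p v * dyck_weight_after a b (last (p # v)) w"
  by (induction v arbitrary: p) (simp_all add: mult.assoc)

lemma dyck_weight_after_dyck_of: "dyck_weight_after a b p (dyck_of t) = dyck_weight a b (dyck_of t)"
  by (cases t) (simp_all add: dyck_weight_eq_after)

lemma dyck_weight_Nil [simp]: "dyck_weight a b [] = 1"
  by (simp add: dyck_weight_def)

lemma dyck_weight_dyck_of_N:
  "dyck_weight a b (dyck_of (N l r)) =
     (if l = L then a else b) * dyck_weight a b (dyck_of l) * dyck_weight a b (dyck_of r)"
proof -
  have "last (U # dyck_of l) = U \<longleftrightarrow> l = L"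
    using excursion_not_ends_up[of 0 "dyck_of l"] by (cases l) auto
  then show ?thesis
    unfolding dyck_weight_eq_after[of a b "dyck_of (N l r)"]
    by (simp add: dyck_weight_after_append
        dyck_weight_after_dyck_of mult_ac)
qed

lemma weight_motzkin_of:
  "gmotzkin_weight a b (b ^ 2) (motzkin_of t) = dyck_weight a b (dyck_of t)"
proof -
  have tl: "gmotzkin_weight a b (b ^ 2) (motzkin_of (N l r)) =
      a * gmotzkin_weight a b (b ^ 2) (tl (motzkin_of (N l r)))" for l r
    by (subst motzkin_of_N) simp
  show ?thesis
  proof (induction t rule: motzkin_of.induct)
    case (4 t1 t2 c)
    with tl[of t1 t2] have
      "dyck_weight a b (dyck_of (N t1 t2)) =
        a * gmotzkin_weight a b (b ^ 2) (tl (motzkin_of (N t1 t2)))"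
      by simp
    with 4 show ?case
      by (simp add: dyck_weight_dyck_of_N[of _ _ "N (N t1 t2) c"]
          dyck_weight_dyck_of_N[of _ _ "N t1 t2" c] power2_eq_square mult_ac
          del: dyck_of.simps(2))
  next
    case (5 l1 l2 r1 r2)
    with tl[of r1 r2] show ?case
      by (simp add: dyck_weight_dyck_of_N[of _ _ "N l1 l2" "N r1 r2"] mult_ac del: dyck_of.simps(2))
  qed (simp_all add: dyck_weight_dyck_of_N mult_ac del: dyck_of.simps(2))
qed

theorem theorem3p4:
  fixes n :: nat
  shows "\<exists>f. bij_betw f (h_gmotzkin_uvu_uu n) (dyck (n + 1)) \<and>
             (\<forall>w \<in> h_gmotzkin_uvu_uu n.
                dyck_weight indet_a indet_b (f w) =
                gmotzkin_weight indet_a indet_b (indet_b ^ 2) w)"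
proof (intro exI conjI ballI)
  let ?M = "{t. nodes t = n + 1}"
  let ?f = "dyck_of \<circ> the_inv_into ?M motzkin_of"
  show "bij_betw ?f (h_gmotzkin_uvu_uu n) (dyck (n + 1))"
    by (rule bij_betw_trans[OF bij_betw_the_inv_into[OF bij_betw_motzkin_of] bij_betw_dyck_of])
  fix w
  assume "w \<in> h_gmotzkin_uvu_uu n"
  then have "motzkin_of (the_inv_into ?M motzkin_of w) = w"
    using bij_betw_motzkin_of[of n] by (intro f_the_inv_into_f_bij_betw) auto
  then show "dyck_weight indet_a indet_b (?f w) =
      gmotzkin_weight indet_a indet_b (indet_b ^ 2) w"
    by (metis comp_apply weight_motzkin_of)
qed

end
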